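(* Let $n\ge 7$ and let $\mathcal{M}$ be a Macbeath map of type $\{3,n\}$ with orientation-preserving automorphism group $\mathrm{PSL}_2(q)$. Let $\pm t$ be the trace of an automorphism (viewed as a matrix in $\mathrm{SL}_2(q)$ up to sign) rotating $\mathcal{M}$ by $2\pi/n$ around a vertex. Then $\mathcal{M}$ is inner regular if $3-t^2$ is a square in $\mathbb{F}_q$, and outer regular if $3-t^2$ is not a square in $\mathbb{F}_q$.
   Context: A map of type $\{3,n\}$ is a 2-cell embedding of a graph in a closed surface with all vertices of valency $n$ and all faces triangles. It is orientably regular if the surface is orientable and its group $\mathrm{Aut}^+\mathcal{M}$ of orientation-preserving automorphisms acts transitively on directed edges. For $n\ge 7$, a Macbeath map of type $\{3,n\}$ is an orientably regular map of type $\{3,n\}$ with $\mathrm{Aut}^+\mathcal{M}\cong G=\mathrm{PSL}_2(q)$, where $q$ is a prime power coprime to $n$. Such maps are fully regular (the full automorphism group acts transitively on flags). $\mathcal{M}$ is called inner regular if an orientation-reversing automorphism of $\mathcal{M}$ induces, by conjugation, an inner automorphism of $G$ (equivalently $\mathrm{Aut}\,\mathcal{M}\cong G\times\mathrm{C}_2$), and outer regular otherwise. Elements of $\mathrm{PSL}_2(q)$ are matrices of $\mathrm{SL}_2(q)$ modulo $\pm I$, so their traces are defined up to sign and $t^2$ is well defined. *)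

theory Defs
  imports "HOL-Analysis.Determinants" "HOL-Algebra.Coset" "HOL-Algebra.Bij"
begin

text \<open>
  A 2-cell embedding of a graph in a closed surface is given by its flags (the triangles of the
  barycentric subdivision of the surface) together with the three involutions that exchange a flag
  with its neighbour having a different vertex, a different edge or a different face, respectively.
\<close>

record 'f flag_system =
  flags :: "'f set"
  chg_vertex :: "'f \<Rightarrow> 'f"
  chg_edge :: "'f \<Rightarrow> 'f"
  chg_face :: "'f \<Rightarrow> 'f"

definition reach :: "('f \<Rightarrow> 'f) set \<Rightarrow> 'f \<Rightarrow> 'f set" where
  "reach R x = {y. (x, y) \<in> {(u, r u) | u r. r \<in> R}\<^sup>*}"

text \<open>
  Finiteness expresses compactness of the surface, the absence of fixed points expresses that it has
  no boundary, and the four flags of every edge are distinct (there are no semi-edges).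
\<close>

definition surface_map :: "'f flag_system \<Rightarrow> bool" where
  "surface_map M \<longleftrightarrow>
     finite (flags M) \<and> flags M \<noteq> {} \<and>
     (\<forall>r\<in>{chg_vertex M, chg_edge M, chg_face M}. \<forall>x\<in>flags M.
        r x \<in> flags M \<and> r (r x) = x \<and> r x \<noteq> x) \<and>
     (\<forall>x\<in>flags M. chg_vertex M (chg_face M x) = chg_face M (chg_vertex M x) \<and>
        chg_vertex M (chg_face M x) \<noteq> x) \<and>
     (\<forall>x\<in>flags M. reach {chg_vertex M, chg_edge M, chg_face M} x = flags M)"

definition map_vertices :: "'f flag_system \<Rightarrow> 'f set set" where
  "map_vertices M = reach {chg_edge M, chg_face M} ` flags M"

definition map_faces :: "'f flag_system \<Rightarrow> 'f set set" where
  "map_faces M = reach {chg_vertex M, chg_edge M} ` flags M"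

text \<open>
  A directed edge is an edge with a choice of initial vertex; it consists of the two flags at that
  end, one on each side. A loop at a vertex contributes two directed edges starting there, hence
  counts twice for the valency. Likewise the sides of a face are its pairs of flags along the same
  edge, so that an edge met twice by the boundary of a face counts twice.
\<close>

definition directed_edge :: "'f flag_system \<Rightarrow> 'f \<Rightarrow> 'f set" where
  "directed_edge M x = {x, chg_face M x}"

definition face_side :: "'f flag_system \<Rightarrow> 'f \<Rightarrow> 'f set" where
  "face_side M x = {x, chg_vertex M x}"

definition has_type :: "'f flag_system \<Rightarrow> nat \<Rightarrow> nat \<Rightarrow> bool" where
  "has_type M m n \<longleftrightarrow>
     (\<forall>f\<in>map_faces M. card (face_side M ` f) = m) \<and>
     (\<forall>v\<in>map_vertices M. card (directed_edge M ` v) = n)"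

text \<open>
  An orientation of the surface singles out one of the two classes of flags (those on which vertex,
  edge, face occur in positive cyclic order); adjacent flags lie in different classes.
\<close>

definition orientation :: "'f flag_system \<Rightarrow> ('f \<Rightarrow> bool) \<Rightarrow> bool" where
  "orientation M c \<longleftrightarrow>
     (\<forall>r\<in>{chg_vertex M, chg_edge M, chg_face M}. \<forall>x\<in>flags M. c (r x) \<noteq> c x)"

definition orientable :: "'f flag_system \<Rightarrow> bool" where
  "orientable M \<longleftrightarrow> (\<exists>c. orientation M c)"

definition map_auts :: "'f flag_system \<Rightarrow> ('f \<Rightarrow> 'f) set" where
  "map_auts M = {\<phi> \<in> Bij (flags M).
     \<forall>r\<in>{chg_vertex M, chg_edge M, chg_face M}. \<forall>x\<in>flags M. \<phi> (r x) = r (\<phi> x)}"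

definition Aut_map :: "'f flag_system \<Rightarrow> ('f \<Rightarrow> 'f) monoid" where
  "Aut_map M = (BijGroup (flags M))\<lparr>carrier := map_auts M\<rparr>"

definition orientation_preserving :: "'f flag_system \<Rightarrow> ('f \<Rightarrow> 'f) \<Rightarrow> bool" where
  "orientation_preserving M \<phi> \<longleftrightarrow> (\<forall>c. orientation M c \<longrightarrow> (\<forall>x\<in>flags M. c (\<phi> x) = c x))"

definition orientation_reversing :: "'f flag_system \<Rightarrow> ('f \<Rightarrow> 'f) \<Rightarrow> bool" where
  "orientation_reversing M \<phi> \<longleftrightarrow> (\<forall>c. orientation M c \<longrightarrow> (\<forall>x\<in>flags M. c (\<phi> x) \<noteq> c x))"

definition Aut_plus :: "'f flag_system \<Rightarrow> ('f \<Rightarrow> 'f) monoid" where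
  "Aut_plus M = (BijGroup (flags M))\<lparr>carrier := {\<phi> \<in> map_auts M. orientation_preserving M \<phi>}\<rparr>"

definition orientably_regular :: "'f flag_system \<Rightarrow> bool" where
  "orientably_regular M \<longleftrightarrow> surface_map M \<and> orientable M \<and>
     (\<forall>x\<in>flags M. \<forall>y\<in>flags M. \<exists>\<phi>\<in>carrier (Aut_plus M).
        \<phi> ` directed_edge M x = directed_edge M y)"

definition fully_regular :: "'f flag_system \<Rightarrow> bool" where
  "fully_regular M \<longleftrightarrow> surface_map M \<and>
     (\<forall>x\<in>flags M. \<forall>y\<in>flags M. \<exists>\<phi>\<in>carrier (Aut_map M). \<phi> x = y)"

text \<open>
  The composite of the exchanges of edge and face moves a flag to the next flag of the same class
  around its vertex, in the positive sense for positive flags. An automorphism rotating by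
  \<open>2\<pi>/n\<close> around the \<open>n\<close>-valent vertex \<open>v\<close> does this to all positive flags at \<open>v\<close>; it then acts as
  the inverse composite on the negative ones. The other sense of rotation corresponds to
  the opposite orientation.
\<close>

definition vertex_rotation :: "'f flag_system \<Rightarrow> ('f \<Rightarrow> bool) \<Rightarrow> 'f set \<Rightarrow> ('f \<Rightarrow> 'f) \<Rightarrow> bool" where
  "vertex_rotation M c v \<phi> \<longleftrightarrow> \<phi> \<in> carrier (Aut_plus M) \<and>
     (\<forall>x\<in>v. c x \<longrightarrow> \<phi> x = chg_face M (chg_edge M x))"

definition inner_regular :: "'f flag_system \<Rightarrow> bool" where
  "inner_regular M \<longleftrightarrow> fully_regular M \<and>
     (\<exists>\<sigma>\<in>carrier (Aut_map M). orientation_reversing M \<sigma> \<and>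
        (\<exists>g\<in>carrier (Aut_plus M). \<forall>f\<in>carrier (Aut_plus M).
           \<sigma> \<otimes>\<^bsub>Aut_map M\<^esub> f \<otimes>\<^bsub>Aut_map M\<^esub> inv\<^bsub>Aut_map M\<^esub> \<sigma> =
           g \<otimes>\<^bsub>Aut_plus M\<^esub> f \<otimes>\<^bsub>Aut_plus M\<^esub> inv\<^bsub>Aut_plus M\<^esub> g))"

definition outer_regular :: "'f flag_system \<Rightarrow> bool" where
  "outer_regular M \<longleftrightarrow> fully_regular M \<and> \<not> inner_regular M"

definition SL2 :: "('k::field^2^2) monoid" where
  "SL2 = \<lparr>carrier = {A. det A = 1}, mult = (**), one = mat 1\<rparr>"

text \<open>The elements of \<open>PSL2\<close> are the sets \<open>{A, - A}\<close>.\<close>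

definition PSL2 :: "('k::field^2^2) set monoid" where
  "PSL2 = SL2 Mod {mat 1, - mat 1}"

text \<open>The finite field of order \<open>q\<close> is a type \<open>'k\<close> of cardinality \<open>q\<close>.\<close>

definition Macbeath_map :: "'k::{field,finite} itself \<Rightarrow> nat \<Rightarrow> 'f flag_system \<Rightarrow> bool" where
  "Macbeath_map K n M \<longleftrightarrow> 7 \<le> n \<and> orientably_regular M \<and> has_type M 3 n \<and>
     Aut_plus M \<cong> (PSL2 :: ('k^2^2) set monoid) \<and> coprime (CARD('k)) n"

end

theory Submission
  imports Defs
begin

text \<open>
  Let \<open>X, Y\<close> in \<open>SL2\<close> be lifts of the rotations of order \<open>n\<close> and 3 whose product is an involution,
  so that \<open>tr X = \<plusminus>t\<close>, \<open>tr Y = \<plusminus>1\<close>, \<open>tr YX = 0\<close>. The matrix \<open>P = XY - YX\<close> satisfies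
  \<open>PX = X\<inverse>P\<close> and \<open>PY = Y\<inverse>P\<close>, and its determinant is \<open>3 - t\<^sup>2\<close>. This is nonzero, since
  \<open>t\<^sup>2 = 3\<close> would force \<open>X\<^sup>6 = -1\<close>. Hence conjugation by \<open>P\<close> inverts both rotations, and
  it is induced by a reflection of the map. Every other matrix inverting both rotations is a
  multiple of \<open>P\<close>, because a matrix commuting with \<open>X\<close> and \<open>Y\<close> is scalar. So the reflection acts
  as an inner automorphism iff some multiple of \<open>P\<close> has determinant 1, i.e. iff \<open>3 - t\<^sup>2\<close> is a square.
\<close>

section \<open>Two-by-two matrices\<close>

lemma mat2_eq_iff: "(A::'k^2^2) = B \<longleftrightarrow> A$1$1 = B$1$1 \<and> A$1$2 = B$1$2 \<and> A$2$1 = B$2$1 \<and> A$2$2 = B$2$2"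
  by (auto simp: vec_eq_iff forall_2)

lemma mat2_mult:
  fixes A :: "'k::field^2^2"
  shows "(A ** B)$i$j = A$i$1 * B$1$j + A$i$2 * B$2$j"
  by (simp add: matrix_matrix_mult_def sum_2)

lemma trace2: "trace (A::'k::field^2^2) = A$1$1 + A$2$2"
  by (simp add: trace_def sum_2)

lemma mat2_entry: "(mat c :: 'k::field^2^2)$i$j = (if i = j then c else 0)"
  by (simp add: mat_def)

lemmas mat2_simps = mat2_eq_iff mat2_mult trace2 mat2_entry det_2

text \<open>The adjugate: on \<open>SL2\<close> it is the inverse, and being polynomial in the
  entries it also makes sense for singular matrices.\<close>

definition adj2 :: "'k::field^2^2 \<Rightarrow> 'k^2^2" where
  "adj2 A = mat (trace A) - A"

lemma adj2_mult: "adj2 A ** A = mat (det A)" "A ** adj2 A = mat (det A)"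
  by (auto simp: adj2_def mat2_simps algebra_simps)

lemma det_adj2: "det (adj2 A) = det (A :: 'k::field^2^2)"
  by (auto simp: adj2_def mat2_simps algebra_simps)

lemma uminus_mat: "- (mat a :: 'k::field^2^2) = mat (- a)"
  by (auto simp: mat2_simps)

lemma trace_conj2: "trace (Q ** X ** adj2 Q) = det Q * trace (X :: 'k::field^2^2)"
  unfolding adj2_def mat2_simps vector_minus_component by simp algebra

lemma mat2_diff_mult: "((A :: 'k::field^2^2) - B) ** (C :: 'k^2^2) = A ** C - B ** C"
  unfolding mat2_eq_iff mat2_mult vector_minus_component by (simp add: algebra_simps)

lemma mat_add_mat: "(mat a :: 'k::field^2^2) + mat b = mat (a + b)"
  by (auto simp: mat2_simps)

lemma mat_mult_mat: "(mat a :: 'k::field^2^2) ** mat b = mat (a * b)"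
  by (auto simp: mat2_simps)

lemma mat_mult_commute: "(A :: 'k::field^2^2) ** mat b = mat b ** A"
  by (auto simp: mat2_simps)

lemma det_mat2: "det (mat a :: 'k::field^2^2) = a\<^sup>2"
  by (simp add: mat2_simps power2_eq_square)

lemma det_uminus2: "det (- A :: 'k::field^2^2) = det A"
  by (simp add: det_2)

lemma mat2_uminus_mult:
  fixes A B :: "'k::field^2^2"
  shows "(- A) ** B = - (A ** B)" "A ** (- B) = - (A ** B)"
  by (auto simp: mat2_simps)

section \<open>Traces of elements of small order\<close>

lemma cayley_hamilton2:
  fixes A :: "'k::field^2^2"
  assumes "det A = 1"
  shows "A ** A = mat (trace A) ** A - mat 1"
  using assms by (auto simp: mat2_simps algebra_simps)

text \<open>Since \<open>a\<close> is invertible, \<open>A\<close> is scalar, and determinant 1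
  leaves only a sign. Cayley-Hamilton reduces relations on powers of \<open>A\<close> to this linear
  form.\<close>

lemma scalar_in_SL2:
  fixes A :: "'k::field^2^2"
  assumes "det A = 1" "mat a ** A = mat b" "a \<noteq> 0"
  shows "A = mat 1 \<or> A = - mat 1"
proof -
  have e: "A$1$2 = 0" "A$2$1 = 0" "a * A$1$1 = b" "a * A$2$2 = b"
    using assms(2,3) by (auto simp: mat2_simps)
  then have e2: "A$1$1 = A$2$2" using assms(3) by (metis mult_left_cancel)
  have "A$1$1 * A$1$1 = 1" using assms(1) e e2 by (simp add: det_2)
  then have "A$1$1 = 1 \<or> A$1$1 = -1" by (simp add: square_eq_1_iff)
  then show ?thesis using e e2 by (auto simp: mat2_simps)
qed

text \<open>By Cayley-Hamilton, \<open>A^2\<close> scalar makes \<open>trace A\<close> times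
  \<open>A\<close> scalar, so a noncentral \<open>A\<close> must have trace 0.\<close>

lemma trace_of_involution:
  fixes A :: "'k::field^2^2"
  assumes "det A = 1" "A ** A = mat 1 \<or> A ** A = - mat 1" "A \<noteq> mat 1" "A \<noteq> - mat 1"
  shows "trace A = 0"
proof (rule ccontr)
  assume t: "trace A \<noteq> 0"
  obtain e where "A ** A = mat e"
    using assms(2) by (metis uminus_mat)
  then have "mat (trace A) ** A = mat (e + 1)"
    using cayley_hamilton2[OF assms(1)] by (auto simp: mat2_simps algebra_simps)
  then show False using scalar_in_SL2 assms t by blast
qed

text \<open>Two uses of Cayley-Hamilton give \<open>A^3 = (t^2 - 1) A - t\<close> with
  \<open>t = trace A\<close>; for noncentral \<open>A\<close> the coefficient of \<open>A\<close>
  must vanish.\<close>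

lemma trace_of_order3:
  fixes A :: "'k::field^2^2"
  assumes "det A = 1" "A ** A ** A = mat 1 \<or> A ** A ** A = - mat 1" "A \<noteq> mat 1" "A \<noteq> - mat 1"
  shows "(trace A)\<^sup>2 = 1"
proof (rule ccontr)
  assume t: "(trace A)\<^sup>2 \<noteq> 1"
  obtain e where e: "A ** A ** A = mat e"
    using assms(2) by (metis uminus_mat)
  have "A ** A ** A = mat ((trace A)\<^sup>2 - 1) ** A - mat (trace A)"
    using assms(1) unfolding mat2_simps vector_minus_component by (simp, algebra)
  then have "mat ((trace A)\<^sup>2 - 1) ** A = mat (e + trace A)"
    using e by (simp add: algebra_simps mat_add_mat)
  then show False using scalar_in_SL2 assms t by fastforce
qed

text \<open>Used in contrapositive form: a nontrivial sixth power in \<open>PSL2\<close> rules out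
  both traces. If the trace squares to 3, then \<open>W = A^2\<close> has trace 1, so
  \<open>W^2 = W - 1\<close> and \<open>W^3 = W^2 - W = -1\<close>.\<close>

lemma sixth_power_of_exceptional_trace:
  fixes A :: "'k::field^2^2"
  assumes "det A = 1" "trace A = 0 \<or> (trace A)\<^sup>2 = 3"
  shows "(A ** A) ** (A ** A) ** (A ** A) = - mat 1"
proof -
  define W where "W = A ** A"
  have "W ** W ** W = - mat 1"
    using assms(2)
  proof
    assume "trace A = 0"
    then have "W = - mat 1"
      unfolding W_def using cayley_hamilton2[OF assms(1)] by (auto simp: mat2_simps)
    then show ?thesis by (simp add: uminus_mat mat_mult_mat)
  next
    assume t: "(trace A)\<^sup>2 = 3"
    have "trace W = (trace A)\<^sup>2 - 2 * det A"
      unfolding W_def mat2_simps by algebra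
    then have "W ** W = W - mat 1"
      using cayley_hamilton2[of W] assms(1) t by (simp add: W_def det_mul)
    then show ?thesis by (simp add: mat2_diff_mult)
  qed
  then show ?thesis by (simp add: W_def)
qed

section \<open>The additive commutator of two matrices\<close>

definition comm2 :: "'k::field^2^2 \<Rightarrow> 'k^2^2 \<Rightarrow> 'k^2^2" where
  "comm2 A B = A ** B - B ** A"

text \<open>With \<open>P = comm2 A B\<close>, Cayley-Hamilton gives
  \<open>P A + A P = A^2 B - B A^2 = (trace A) P\<close>, and similarly for
  \<open>B\<close>.\<close>

lemma comm2_intertwines:
  fixes A B :: "'k::field^2^2"
  shows "comm2 A B ** A = adj2 A ** comm2 A B" "comm2 A B ** B = adj2 B ** comm2 A B"
  by (auto simp: comm2_def adj2_def mat2_simps algebra_simps)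

text \<open>Fricke's trace identity: the left side is 2 minus the trace of the group commutator of
  \<open>A\<close> and \<open>B\<close>.\<close>

lemma det_comm2:
  fixes A B :: "'k::field^2^2"
  assumes "det A = 1" "det B = 1"
  shows "det (comm2 A B) = 4 + trace A * trace B * trace (B ** A)
    - (trace A)\<^sup>2 - (trace B)\<^sup>2 - (trace (B ** A))\<^sup>2"
proof -
  \<comment> \<open>Inserting \<open>det A\<close> and \<open>det B\<close> as factors gives a
    polynomial identity in the entries.\<close>
  have "det (comm2 A B) = 4 * det A * det B + trace A * trace B * trace (B ** A)
    - (trace A)\<^sup>2 * det B - (trace B)\<^sup>2 * det A - (trace (B ** A))\<^sup>2"
    unfolding comm2_def mat2_simps vector_minus_component by algebra
  then show ?thesis using assms by simp
qed

text \<open>Modulo scalars a matrix is a vector (two off-diagonal entries, difference of the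
  diagonal ones), and matrices commute iff their vectors are parallel. The vectors of
  \<open>A\<close> and \<open>B\<close> are independent, with minors \<open>u\<close>,
  \<open>v\<close>, \<open>w\<close>; that of \<open>C\<close> is parallel to both, hence 0.\<close>

lemma scalar_of_commuting:
  fixes A B C :: "'k::field^2^2"
  assumes "C ** A = A ** C" "C ** B = B ** C" "A ** B \<noteq> B ** A"
  shows "\<exists>c. C = mat c"
proof -
  define x y z where "x = C$1$2" "y = C$2$1" "z = C$1$1 - C$2$2"
  define u where "u = A$1$2 * B$2$1 - A$2$1 * B$1$2"
  define v where "v = A$1$2 * (B$1$1 - B$2$2) - B$1$2 * (A$1$1 - A$2$2)"
  define w where "w = A$2$1 * (B$1$1 - B$2$2) - B$2$1 * (A$1$1 - A$2$2)"
  have ne: "u \<noteq> 0 \<or> v \<noteq> 0 \<or> w \<noteq> 0"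
    using assms(3) by (auto simp: u_def v_def w_def mat2_simps algebra_simps)
  have "u * x = 0 \<and> u * y = 0 \<and> u * z = 0 \<and> v * x = 0 \<and> v * y = 0 \<and> v * z = 0
    \<and> w * x = 0 \<and> w * y = 0 \<and> w * z = 0"
    using assms(1,2) unfolding u_def v_def w_def x_y_z_def mat2_simps by algebra
  then have "x = 0 \<and> y = 0 \<and> z = 0" using ne by auto
  then have "C = mat (C$1$1)" by (auto simp: x_y_z_def mat2_simps)
  then show ?thesis by blast
qed

text \<open>\<open>adj2 Q ** comm2 A B\<close> commutes with \<open>A\<close> and \<open>B\<close>, hence is scalar.\<close>

lemma det_comm2_square:
  fixes A B Q :: "'k::field^2^2"
  assumes Q: "det Q = 1" "Q ** A = adj2 A ** Q" "Q ** B = adj2 B ** Q" and ne: "det (comm2 A B) \<noteq> 0"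
  shows "\<exists>s. det (comm2 A B) = s\<^sup>2"
proof -
  let ?P = "comm2 A B"
  have comm: "adj2 Q ** ?P ** X = X ** (adj2 Q ** ?P)"
    if QX: "Q ** X = adj2 X ** Q" and PX: "?P ** X = adj2 X ** ?P" for X
  proof -
    have "adj2 Q ** adj2 X = adj2 Q ** (adj2 X ** Q) ** adj2 Q"
      by (simp add: matrix_mul_assoc[symmetric] adj2_mult Q)
    also have "\<dots> = X ** adj2 Q"
      by (simp add: matrix_mul_assoc adj2_mult Q flip: QX)
    finally have "adj2 Q ** adj2 X = X ** adj2 Q" .
    then show ?thesis by (metis PX matrix_mul_assoc)
  qed
  have "A ** B \<noteq> B ** A" using ne by (auto simp: comm2_def det_2)
  \<comment> \<open>As \<open>adj2 Q\<close> is the inverse of \<open>Q\<close>, this says that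
    \<open>?P\<close> is \<open>s\<close> times \<open>Q\<close>.\<close>
  then obtain s where "adj2 Q ** ?P = mat s"
    using scalar_of_commuting comm[OF Q(2) comm2_intertwines(1)] comm[OF Q(3) comm2_intertwines(2)]
    by blast
  then have "det (adj2 Q) * det ?P = s\<^sup>2" by (metis det_mul det_mat2)
  then show ?thesis using Q(1) by (auto simp: det_adj2)
qed

section \<open>Inverting automorphisms of \<open>PSL2\<close>\<close>

text \<open>The class of \<open>A\<close> modulo sign; a singleton in characteristic 2.\<close>

definition pm :: "'k::field^2^2 \<Rightarrow> ('k^2^2) set" where
  "pm A = {A, - A}"

lemma pm_eq_iff: "pm A = pm B \<longleftrightarrow> A = B \<or> A = - B"
  by (auto simp: pm_def doubleton_eq_iff)

lemma carrier_PSL2: "carrier PSL2 = pm ` {A :: 'k::field^2^2. det A = 1}"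
  by (auto simp: PSL2_def SL2_def FactGroup_def RCOSETS_def r_coset_def pm_def mat2_uminus_mult)

lemma pm_in_PSL2: "det A = 1 \<Longrightarrow> pm A \<in> carrier PSL2"
  by (simp add: carrier_PSL2)

lemma mult_PSL2: "pm A \<otimes>\<^bsub>PSL2\<^esub> pm B = pm (A ** B :: 'k::field^2^2)"
  by (auto simp: PSL2_def SL2_def FactGroup_def set_mult_def pm_def mat2_uminus_mult)

lemma one_PSL2: "\<one>\<^bsub>PSL2\<^esub> = pm (mat 1 :: 'k::field^2^2)"
  by (simp add: PSL2_def FactGroup_def pm_def)

lemma group_PSL2: "group (PSL2 :: ('k::field^2^2) set monoid)"
proof (rule groupI)
  fix x :: "('k^2^2) set"
  assume "x \<in> carrier PSL2"
  then obtain A where A: "det A = 1" "x = pm A" by (auto simp: carrier_PSL2)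
  then have "pm (adj2 A) \<otimes>\<^bsub>PSL2\<^esub> x = \<one>\<^bsub>PSL2\<^esub>"
    by (simp add: mult_PSL2 one_PSL2 adj2_mult)
  then show "\<exists>y\<in>carrier PSL2. y \<otimes>\<^bsub>PSL2\<^esub> x = \<one>\<^bsub>PSL2\<^esub>"
    using A by (metis pm_in_PSL2 det_adj2)
qed (auto simp: carrier_PSL2 mult_PSL2 one_PSL2 det_mul matrix_mul_assoc)

lemma inv_PSL2:
  assumes "det A = 1"
  shows "inv\<^bsub>PSL2\<^esub> (pm A) = pm (adj2 (A :: 'k::field^2^2))"
proof -
  interpret group "PSL2 :: ('k^2^2) set monoid" by (rule group_PSL2)
  show ?thesis
    using assms by (intro inv_equality) (auto simp: pm_in_PSL2 det_adj2 mult_PSL2 one_PSL2 adj2_mult)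
qed

lemma conj_pm: "(\<lambda>A. P ** A ** R) ` pm A = pm (P ** A ** R :: 'k::field^2^2)"
  by (auto simp: pm_def mat2_uminus_mult)

text \<open>\<open>P\<close> need not have determinant 1: conjugation by any invertible matrix
  preserves determinants and signs. Such automorphisms come from \<open>PGL2\<close> and may be
  outer.\<close>

lemma conj_iso_PSL2:
  fixes P R :: "'k::field^2^2"
  assumes PR: "P ** R = mat 1"
  shows "(\<lambda>S. (\<lambda>A. P ** A ** R) ` S) \<in> iso PSL2 PSL2"
proof -
  have RP: "R ** P = mat 1" using PR by (simp add: matrix_left_right_inverse)
  have d: "det P * det R = 1" by (metis PR det_mul det_I)
  have cancel: "P ** A ** R ** (P ** B ** R) = P ** (A ** B) ** R" for A B :: "'k^2^2"
    by (metis RP matrix_mul_assoc matrix_mul_rid)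
  have inv1: "R ** (P ** A ** R) ** P = A" for A :: "'k^2^2"
    by (simp add: RP matrix_mul_assoc) (simp add: RP flip: matrix_mul_assoc)
  have inv2: "P ** (R ** A ** P) ** R = A" for A :: "'k^2^2"
    by (simp add: PR matrix_mul_assoc) (simp add: PR flip: matrix_mul_assoc)
  have d1: "det (P ** A ** R) = 1" "det (R ** A ** P) = 1" if "det A = 1" for A :: "'k^2^2"
    using that d by (simp_all add: det_mul mult.commute)
  have "bij_betw (\<lambda>S. (\<lambda>A. P ** A ** R) ` S) (carrier PSL2) (carrier PSL2)"
    by (rule bij_betw_byWitness[where f' = "\<lambda>S. (\<lambda>A. R ** A ** P) ` S"])
      (auto simp: carrier_PSL2 conj_pm inv1 inv2 d1)
  moreover have "(\<lambda>S. (\<lambda>A. P ** A ** R) ` S) \<in> hom PSL2 PSL2"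
  proof (rule homI)
    fix x y :: "('k^2^2) set"
    assume "x \<in> carrier PSL2" "y \<in> carrier PSL2"
    then obtain A B where "x = pm A" "y = pm B" by (auto simp: carrier_PSL2)
    then show "(\<lambda>A. P ** A ** R) ` (x \<otimes>\<^bsub>PSL2\<^esub> y) =
        (\<lambda>A. P ** A ** R) ` x \<otimes>\<^bsub>PSL2\<^esub> (\<lambda>A. P ** A ** R) ` y"
      by (simp only: mult_PSL2 conj_pm cancel)
  qed (auto simp: carrier_PSL2 conj_pm d1)
  ultimately show ?thesis by (simp add: iso_def)
qed

text \<open>The relations are those of the rotations of a map with triangular faces;
  \<open>x6\<close> keeps \<open>trace A\<close> away from 0 and its square away from 3. The choice
  of lift \<open>A\<close> is immaterial, as only the square of its trace occurs.\<close>

lemma inverting_in_PSL2: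
  fixes A :: "'k::field^2^2"
  assumes x: "x \<in> carrier PSL2" and y: "y \<in> carrier PSL2" and A: "A \<in> x"
    and x6: "(x \<otimes>\<^bsub>PSL2\<^esub> x) \<otimes>\<^bsub>PSL2\<^esub> (x \<otimes>\<^bsub>PSL2\<^esub> x) \<otimes>\<^bsub>PSL2\<^esub> (x \<otimes>\<^bsub>PSL2\<^esub> x) \<noteq> \<one>\<^bsub>PSL2\<^esub>"
    and y3: "y \<otimes>\<^bsub>PSL2\<^esub> y \<otimes>\<^bsub>PSL2\<^esub> y = \<one>\<^bsub>PSL2\<^esub>" "y \<noteq> \<one>\<^bsub>PSL2\<^esub>"
    and yx: "(y \<otimes>\<^bsub>PSL2\<^esub> x) \<otimes>\<^bsub>PSL2\<^esub> (y \<otimes>\<^bsub>PSL2\<^esub> x) = \<one>\<^bsub>PSL2\<^esub>" "y \<otimes>\<^bsub>PSL2\<^esub> x \<noteq> \<one>\<^bsub>PSL2\<^esub>"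
  shows "\<exists>\<theta>\<in>iso PSL2 PSL2. \<theta> x = inv\<^bsub>PSL2\<^esub> x \<and> \<theta> y = inv\<^bsub>PSL2\<^esub> y"
    and "(\<exists>s. 3 - (trace A)\<^sup>2 = s\<^sup>2) \<longleftrightarrow>
      (\<exists>g\<in>carrier PSL2. g \<otimes>\<^bsub>PSL2\<^esub> x = inv\<^bsub>PSL2\<^esub> x \<otimes>\<^bsub>PSL2\<^esub> g \<and> g \<otimes>\<^bsub>PSL2\<^esub> y = inv\<^bsub>PSL2\<^esub> y \<otimes>\<^bsub>PSL2\<^esub> g)"
proof -
  have xA: "x = pm A" "det A = 1"
    using x A by (auto simp: carrier_PSL2 pm_def det_uminus2)
  obtain B where yB: "y = pm B" "det B = 1" using y by (auto simp: carrier_PSL2)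
  have trB: "(trace B)\<^sup>2 = 1"
    using trace_of_order3[of B] y3 yB by (auto simp: mult_PSL2 one_PSL2 pm_eq_iff)
  have trBA: "trace (B ** A) = 0"
    using trace_of_involution[of "B ** A"] yx yB xA by (auto simp: mult_PSL2 one_PSL2 pm_eq_iff det_mul)
  have "(A ** A) ** (A ** A) ** (A ** A) \<noteq> - mat 1"
    using x6 by (auto simp: xA mult_PSL2 one_PSL2 pm_eq_iff)
  then have trA: "trace A \<noteq> 0" "(trace A)\<^sup>2 \<noteq> 3"
    using sixth_power_of_exceptional_trace xA by blast+
  define P where "P = comm2 A B"
  have detP: "det P = 3 - (trace A)\<^sup>2"
    using det_comm2[of A B] xA yB trB trBA by (simp add: P_def)
  then have nz: "det P \<noteq> 0" using trA by simp
  have P: "P ** A = adj2 A ** P" "P ** B = adj2 B ** P"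
    by (simp_all add: P_def comm2_intertwines)
  \<comment> \<open>\<open>adj2 P\<close> inverts \<open>P\<close> only up to the factor
    \<open>det P\<close>.\<close>
  define R where "R = mat (1 / det P) ** adj2 P"
  have PR: "P ** R = mat 1"
    unfolding R_def using nz by (metis adj2_mult(2) mat_mult_commute matrix_mul_assoc mat_mult_mat nonzero_eq_divide_eq mult.commute)
  have "P ** A ** R = adj2 A" "P ** B ** R = adj2 B"
    unfolding P by (simp_all add: PR flip: matrix_mul_assoc)
  then show "\<exists>\<theta>\<in>iso PSL2 PSL2. \<theta> x = inv\<^bsub>PSL2\<^esub> x \<and> \<theta> y = inv\<^bsub>PSL2\<^esub> y"
    using conj_iso_PSL2[OF PR] by (intro bexI) (auto simp: xA yB conj_pm inv_PSL2)
  show "(\<exists>s. 3 - (trace A)\<^sup>2 = s\<^sup>2) \<longleftrightarrow>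
      (\<exists>g\<in>carrier PSL2. g \<otimes>\<^bsub>PSL2\<^esub> x = inv\<^bsub>PSL2\<^esub> x \<otimes>\<^bsub>PSL2\<^esub> g \<and> g \<otimes>\<^bsub>PSL2\<^esub> y = inv\<^bsub>PSL2\<^esub> y \<otimes>\<^bsub>PSL2\<^esub> g)"
  proof
    assume "\<exists>s. 3 - (trace A)\<^sup>2 = s\<^sup>2"
    then obtain s where s: "det P = s\<^sup>2" using detP by auto
    then have "s \<noteq> 0" using nz by auto
    \<comment> \<open>Rescaling by \<open>1 / s\<close> divides the determinant \<open>s^2\<close>
      by itself.\<close>
    define Q where "Q = mat (1 / s) ** P"
    have "det Q = 1"
      unfolding Q_def using s \<open>s \<noteq> 0\<close> by (simp add: det_mul det_mat2 power_divide)
    moreover have "Q ** A = adj2 A ** Q" "Q ** B = adj2 B ** Q"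
      unfolding Q_def by (metis P mat_mult_commute matrix_mul_assoc)+
    ultimately show "\<exists>g\<in>carrier PSL2. g \<otimes>\<^bsub>PSL2\<^esub> x = inv\<^bsub>PSL2\<^esub> x \<otimes>\<^bsub>PSL2\<^esub> g \<and> g \<otimes>\<^bsub>PSL2\<^esub> y = inv\<^bsub>PSL2\<^esub> y \<otimes>\<^bsub>PSL2\<^esub> g"
      by (intro bexI[of _ "pm Q"]) (auto simp: pm_in_PSL2 xA yB mult_PSL2 inv_PSL2)
  next
    assume "\<exists>g\<in>carrier PSL2. g \<otimes>\<^bsub>PSL2\<^esub> x = inv\<^bsub>PSL2\<^esub> x \<otimes>\<^bsub>PSL2\<^esub> g \<and> g \<otimes>\<^bsub>PSL2\<^esub> y = inv\<^bsub>PSL2\<^esub> y \<otimes>\<^bsub>PSL2\<^esub> g"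
    \<comment> \<open>Equality in \<open>PSL2\<close> leaves an independent sign for each of the two
      generators.\<close>
    then obtain Q where Q: "det Q = 1"
      and QA: "Q ** A = adj2 A ** Q \<or> Q ** A = - (adj2 A ** Q)"
      and QB: "Q ** B = adj2 B ** Q \<or> Q ** B = - (adj2 B ** Q)"
      by (auto simp: carrier_PSL2 xA yB mult_PSL2 inv_PSL2 pm_eq_iff)
    \<comment> \<open>a sign \<open>-1\<close> would give \<open>2 * trace X = 0\<close>, so characteristic 2, where signs do not matter\<close>
    have sgn: "Q ** X = adj2 X ** Q"
      if X: "Q ** X = adj2 X ** Q \<or> Q ** X = - (adj2 X ** Q)" and tr: "trace X \<noteq> 0" for X
    proof (rule ccontr)
      assume n: "Q ** X \<noteq> adj2 X ** Q"
      then have e: "Q ** X = - (adj2 X ** Q)" using X by simp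
      have "trace X = trace (Q ** X ** adj2 Q)"
        using trace_conj2[of Q X] Q by simp
      also have "Q ** X ** adj2 Q = - adj2 X"
        using Q by (simp add: e mat2_uminus_mult adj2_mult flip: matrix_mul_assoc)
      also have "trace (- adj2 X) = - trace X"
        by (simp add: adj2_def mat2_simps)
      finally have "trace X = - trace X" .
      then have "(1 + 1) * trace X = 0" by (metis add.right_inverse distrib_right mult_1)
      then have "1 + 1 = (0 :: 'k)" using tr by (simp del: one_add_one)
      then have "(-1 :: 'k) = 1" by (simp add: add_eq_0_iff del: one_add_one)
      moreover have "- (adj2 X ** Q) = mat (-1) ** (adj2 X ** Q)"
        by (simp add: mat2_simps)
      ultimately have "Q ** X = mat 1 ** (adj2 X ** Q)" using e by metis
      then show False using n by simp
    qed
    \<comment> \<open>Removing the signs needs both traces nonzero; for \<open>A\<close> this came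
      from \<open>x6\<close>.\<close>
    have "trace B \<noteq> 0" using trB by auto
    then show "\<exists>s. 3 - (trace A)\<^sup>2 = s\<^sup>2"
      using det_comm2_square[OF Q sgn[OF QA] sgn[OF QB]] trA nz detP by (simp add: P_def)
  qed
qed

text \<open>Transport along \<open>h\<close>: the equations pass to \<open>PSL2\<close> as
  \<open>h\<close> is a homomorphism, the inequations as it is injective, and
  \<open>\<theta>\<close> is conjugated back by \<open>h\<close>.\<close>

lemma inverting_in_group_iso_PSL2:
  fixes A :: "'k::field^2^2" and G (structure)
  assumes G: "group G" and h: "h \<in> iso G PSL2"
    and x: "x \<in> carrier G" and y: "y \<in> carrier G" and A: "A \<in> h x"
    and x6: "(x \<otimes> x) \<otimes> (x \<otimes> x) \<otimes> (x \<otimes> x) \<noteq> \<one>"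
    and y3: "y \<otimes> y \<otimes> y = \<one>" "y \<noteq> \<one>"
    and yx: "(y \<otimes> x) \<otimes> (y \<otimes> x) = \<one>" "y \<otimes> x \<noteq> \<one>"
  shows "\<exists>\<theta>\<in>iso G G. \<theta> x = inv x \<and> \<theta> y = inv y"
    and "(\<exists>s. 3 - (trace A)\<^sup>2 = s\<^sup>2) \<longleftrightarrow>
      (\<exists>g\<in>carrier G. g \<otimes> x = inv x \<otimes> g \<and> g \<otimes> y = inv y \<otimes> g)"
proof -
  interpret group G by (rule G)
  interpret group_hom G "PSL2 :: ('k^2^2) set monoid" h
    using G group_PSL2 h by (simp add: group_hom_def group_hom_axioms_def iso_def)
  have bij: "bij_betw h (carrier G) (carrier PSL2)" using h by (simp add: iso_def)
  then have inj: "h u = h v \<longleftrightarrow> u = v" if "u \<in> carrier G" "v \<in> carrier G" for u v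
    using that by (metis bij_betw_inv_into_left)
  have one: "h u = \<one>\<^bsub>PSL2\<^esub> \<longleftrightarrow> u = \<one>" if "u \<in> carrier G" for u
    using inj[OF that group.is_monoid[OF G, THEN monoid.one_closed]] by simp
  have eq: "h u \<otimes>\<^bsub>PSL2\<^esub> h v = \<one>\<^bsub>PSL2\<^esub> \<longleftrightarrow> u \<otimes> v = \<one>"
    if "u \<in> carrier G" "v \<in> carrier G" for u v
    using that one[of "u \<otimes> v"] by simp
  have hx: "h x \<in> carrier PSL2" and hy: "h y \<in> carrier PSL2"
    using x y by simp_all
  have x6': "(h x \<otimes>\<^bsub>PSL2\<^esub> h x) \<otimes>\<^bsub>PSL2\<^esub> (h x \<otimes>\<^bsub>PSL2\<^esub> h x) \<otimes>\<^bsub>PSL2\<^esub> (h x \<otimes>\<^bsub>PSL2\<^esub> h x) \<noteq> \<one>\<^bsub>PSL2\<^esub>"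
    using x6 x eq[of "x \<otimes> x \<otimes> (x \<otimes> x)" "x \<otimes> x"] by simp
  have y3': "h y \<otimes>\<^bsub>PSL2\<^esub> h y \<otimes>\<^bsub>PSL2\<^esub> h y = \<one>\<^bsub>PSL2\<^esub>" "h y \<noteq> \<one>\<^bsub>PSL2\<^esub>"
    using y3 y eq[of "y \<otimes> y" y] one[of y] by simp_all
  have yx': "(h y \<otimes>\<^bsub>PSL2\<^esub> h x) \<otimes>\<^bsub>PSL2\<^esub> (h y \<otimes>\<^bsub>PSL2\<^esub> h x) = \<one>\<^bsub>PSL2\<^esub>"
      "h y \<otimes>\<^bsub>PSL2\<^esub> h x \<noteq> \<one>\<^bsub>PSL2\<^esub>"
    using yx y x eq[of "y \<otimes> x" "y \<otimes> x"] eq[of y x] by simp_all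
  note th = inverting_in_PSL2(1)[OF hx hy A x6' y3' yx']
  note sq = inverting_in_PSL2(2)[OF hx hy A x6' y3' yx']
  from th obtain \<theta> where \<theta>: "\<theta> \<in> iso PSL2 PSL2" "\<theta> (h x) = h (inv x)" "\<theta> (h y) = h (inv y)"
    using hom_inv x y by metis
  have "inv_into (carrier G) h \<circ> \<theta> \<circ> h \<in> iso G G"
    using iso_set_trans[OF iso_set_trans[OF h \<theta>(1)] group.iso_set_sym[OF G h]] by (simp add: comp_assoc)
  moreover have "inv_into (carrier G) h (h u) = u" if "u \<in> carrier G" for u
    using bij that by (simp add: bij_betw_inv_into_left)
  ultimately show "\<exists>\<theta>\<in>iso G G. \<theta> x = inv x \<and> \<theta> y = inv y"
    using \<theta> x y by (intro bexI) (auto simp del: hom_inv)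
  have comm: "h g \<otimes>\<^bsub>PSL2\<^esub> h u = inv\<^bsub>PSL2\<^esub> h u \<otimes>\<^bsub>PSL2\<^esub> h g \<longleftrightarrow> g \<otimes> u = inv u \<otimes> g"
    if "g \<in> carrier G" "u \<in> carrier G" for g u
    using that inj[of "g \<otimes> u" "inv u \<otimes> g"] by simp
  have "carrier PSL2 = h ` carrier G" using bij by (simp add: bij_betw_def)
  then show "(\<exists>s. 3 - (trace A)\<^sup>2 = s\<^sup>2) \<longleftrightarrow>
      (\<exists>g\<in>carrier G. g \<otimes> x = inv x \<otimes> g \<and> g \<otimes> y = inv y \<otimes> g)"
    unfolding sq by (simp add: comm x y)
qed

section \<open>Automorphisms of orientably regular maps\<close>

lemma reach_refl: "x \<in> reach R x"
  by (simp add: reach_def)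

lemma reach_step: "\<lbrakk>y \<in> reach R x; r \<in> R\<rbrakk> \<Longrightarrow> r y \<in> reach R x"
  by (auto simp: reach_def intro: rtrancl_into_rtrancl)

lemma reach_induct [consumes 1, case_names refl step]:
  assumes "y \<in> reach R x" "P x" "\<And>z r. \<lbrakk>z \<in> reach R x; P z; r \<in> R\<rbrakk> \<Longrightarrow> P (r z)"
  shows "P y"
proof -
  have "(x, y) \<in> {(u, r u) | u r. r \<in> R}\<^sup>*" using assms(1) by (simp add: reach_def)
  then show ?thesis
    by (induction rule: rtrancl_induct) (use assms(2,3) in \<open>auto simp: reach_def\<close>)
qed

lemma reach_trans: "\<lbrakk>y \<in> reach R x; z \<in> reach R y\<rbrakk> \<Longrightarrow> z \<in> reach R x"
  by (auto simp: reach_def)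

text \<open>Lets an orbit be based at an adjacent flag, so that a positive flag can be chosen at a
  given vertex.\<close>

lemma reach_involution:
  assumes "r \<in> R" "r (r x) = x"
  shows "reach R (r x) = reach R x"
  using reach_step[OF reach_refl assms(1)] assms(2) by (metis reach_trans subsetI subset_antisym)

lemma (in group) conjugation_iso:
  assumes "g \<in> carrier G"
  shows "(\<lambda>f. g \<otimes> f \<otimes> inv g) \<in> iso G G"
proof -
  have cancel: "inv g \<otimes> (g \<otimes> f) = f" "g \<otimes> (inv g \<otimes> f) = f" if "f \<in> carrier G" for f
    using assms that by (simp_all flip: m_assoc)
  have "(\<lambda>f. g \<otimes> f \<otimes> inv g) \<in> hom G G"
    by (rule homI) (use assms in \<open>simp_all add: m_assoc cancel\<close>)
  moreover have "bij_betw (\<lambda>f. g \<otimes> f \<otimes> inv g) (carrier G) (carrier G)"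
    by (rule bij_betw_byWitness[where f' = "\<lambda>f. inv g \<otimes> f \<otimes> g"])
      (use assms in \<open>auto simp: m_assoc cancel\<close>)
  ultimately show ?thesis by (simp add: iso_def)
qed

locale oriented_regular_map =
  fixes M :: "'f flag_system" and c :: "'f \<Rightarrow> bool"
  assumes regular: "orientably_regular M" and orient: "orientation M c"
begin

abbreviation "r0 \<equiv> chg_vertex M"
abbreviation "r1 \<equiv> chg_edge M"
abbreviation "r2 \<equiv> chg_face M"
abbreviation "G \<equiv> Aut_plus M"

lemma surface: "surface_map M"
  using regular by (simp add: orientably_regular_def)

lemma
  assumes "x \<in> flags M"
  shows r0: "r0 x \<in> flags M" "r0 (r0 x) = x"
    and r1: "r1 x \<in> flags M" "r1 (r1 x) = x"
    and r2: "r2 x \<in> flags M" "r2 (r2 x) = x"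
    and r02: "r0 (r2 x) = r2 (r0 x)" "r0 (r2 x) \<noteq> x"
  using surface assms by (auto simp: surface_map_def)

lemma
  assumes "x \<in> flags M"
  shows c0: "c (r0 x) \<longleftrightarrow> \<not> c x" and c1: "c (r1 x) \<longleftrightarrow> \<not> c x" and c2: "c (r2 x) \<longleftrightarrow> \<not> c x"
  using orient assms by (auto simp: orientation_def)

text \<open>Connectedness of the surface as an induction principle.\<close>

lemma flags_induct [consumes 2, case_names base step]:
  assumes "x \<in> flags M" "y \<in> flags M" "P x"
    and "\<And>z r. \<lbrakk>z \<in> flags M; P z; r \<in> {r0, r1, r2}\<rbrakk> \<Longrightarrow> P (r z)"
  shows "P y"
proof -
  have "reach {r0, r1, r2} x = flags M" using surface assms(1) by (simp add: surface_map_def)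
  with assms(2) have "y \<in> reach {r0, r1, r2} x" by simp
  then have "y \<in> flags M \<and> P y"
    by (induction rule: reach_induct) (use assms r0 r1 r2 in auto)
  then show ?thesis ..
qed

lemma
  assumes "\<phi> \<in> map_auts M" "x \<in> flags M"
  shows aut_flags: "\<phi> x \<in> flags M"
    and aut_r0: "\<phi> (r0 x) = r0 (\<phi> x)"
    and aut_r1: "\<phi> (r1 x) = r1 (\<phi> x)"
    and aut_r2: "\<phi> (r2 x) = r2 (\<phi> x)"
  using assms by (auto simp: map_auts_def Bij_def bij_betw_def)

text \<open>Rigidity: agreement at one flag spreads to adjacent flags; off the flags both maps are
  extensional.\<close>

lemma aut_eqI:
  assumes "\<phi> \<in> map_auts M" "\<psi> \<in> map_auts M" "x \<in> flags M" "\<phi> x = \<psi> x"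
  shows "\<phi> = \<psi>"
proof (rule extensionalityI)
  show "\<phi> \<in> extensional (flags M)" "\<psi> \<in> extensional (flags M)"
    using assms(1,2) by (auto simp: map_auts_def Bij_def)
  fix y assume "y \<in> flags M"
  with assms(3) show "\<phi> y = \<psi> y"
    by (induction rule: flags_induct)
      (use assms in \<open>auto simp: aut_r0 aut_r1 aut_r2\<close>)
qed

text \<open>Every exchange flips both \<open>c\<close> and \<open>d\<close>, so by connectedness
  they agree on all flags or on none. Hence one fixed orientation \<open>c\<close> suffices
  below.\<close>

lemma orientation_change:
  assumes "orientation M d" "x \<in> flags M" "y \<in> flags M"
  shows "(d x = d y) = (c x = c y)"
  using assms(2,3)
proof (induction rule: flags_induct)
  case (step z r)
  then show ?case using orient assms(1) unfolding orientation_def by metis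
qed simp

text \<open>Since \<open>\<phi>\<close> commutes with the exchanges, each flipping \<open>c\<close>,
  its effect on \<open>c\<close> is decided at a single flag.\<close>

lemma aut_orientation:
  assumes "\<phi> \<in> map_auts M" "x \<in> flags M" "y \<in> flags M"
  shows "(c (\<phi> y) = c y) = (c (\<phi> x) = c x)"
  using assms(2,3)
  by (induction rule: flags_induct)
    (use assms in \<open>auto simp: aut_r0 aut_r1 aut_r2 aut_flags c0 c1 c2\<close>)

lemma orientation_preserving_iff:
  assumes "\<phi> \<in> map_auts M" "x \<in> flags M"
  shows "orientation_preserving M \<phi> \<longleftrightarrow> c (\<phi> x) = c x"
  unfolding orientation_preserving_def
  using orientation_change aut_orientation orient assms aut_flags by metis

lemma orientation_reversing_iff:
  assumes "\<phi> \<in> map_auts M" "x \<in> flags M"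
  shows "orientation_reversing M \<phi> \<longleftrightarrow> c (\<phi> x) \<noteq> c x"
  unfolding orientation_reversing_def
  using orientation_change aut_orientation orient assms aut_flags by metis

section \<open>The groups \<open>Aut_map\<close> and \<open>Aut_plus\<close>\<close>

lemma carrier_Aut_map: "carrier (Aut_map M) = map_auts M"
  by (simp add: Aut_map_def)

lemma Aut_plus_map_auts: "\<phi> \<in> carrier G \<Longrightarrow> \<phi> \<in> map_auts M"
  by (simp add: Aut_plus_def)

lemma carrier_Aut_plus:
  "x \<in> flags M \<Longrightarrow> carrier G = {\<phi> \<in> map_auts M. c (\<phi> x) = c x}"
  using orientation_preserving_iff by (auto simp: Aut_plus_def)

lemma subgroup_map_auts: "subgroup (map_auts M) (BijGroup (flags M))"
proof
  show "map_auts M \<subseteq> carrier (BijGroup (flags M))"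
    by (auto simp: map_auts_def BijGroup_def)
  show "\<phi> \<otimes>\<^bsub>BijGroup (flags M)\<^esub> \<psi> \<in> map_auts M" if "\<phi> \<in> map_auts M" "\<psi> \<in> map_auts M" for \<phi> \<psi>
  proof -
    have "\<phi> \<in> Bij (flags M)" "\<psi> \<in> Bij (flags M)" using that by (auto simp: map_auts_def)
    then show ?thesis
      using that by (auto simp: map_auts_def BijGroup_def compose_def compose_Bij[unfolded compose_def] r0 r1 r2
        aut_flags[OF that(2)])
  qed
  show "\<one>\<^bsub>BijGroup (flags M)\<^esub> \<in> map_auts M"
    using id_Bij by (auto simp: map_auts_def BijGroup_def r0 r1 r2)
  show "inv\<^bsub>BijGroup (flags M)\<^esub> \<phi> \<in> map_auts M" if "\<phi> \<in> map_auts M" for \<phi>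
  proof -
    have bij: "\<phi> \<in> Bij (flags M)" using that by (auto simp: map_auts_def)
    then have bb: "bij_betw \<phi> (flags M) (flags M)" by (simp add: Bij_def)
    have "inv_into (flags M) \<phi> (r x) = r (inv_into (flags M) \<phi> x)"
      if "x \<in> flags M" "r \<in> {r0, r1, r2}" for x r
    proof -
      have "x \<in> \<phi> ` flags M" using bb that(1) by (simp add: bij_betw_imp_surj_on)
      then obtain y where y: "y \<in> flags M" "\<phi> y = x" by blast
      have ry: "r y \<in> flags M" "\<phi> (r y) = r (\<phi> y)"
        using that(2) y(1) \<open>\<phi> \<in> map_auts M\<close> aut_r0 aut_r1 aut_r2 r0 r1 r2 by auto
      have "inv_into (flags M) \<phi> (\<phi> z) = z" if "z \<in> flags M" for z
        using bb that by (rule bij_betw_inv_into_left)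
      from this[OF y(1)] this[OF ry(1)] show ?thesis by (simp only: ry(2) y(2))
    qed
    then show ?thesis
      using bij restrict_inv_into_Bij[OF bij] by (auto simp: map_auts_def inv_BijGroup r0 r1 r2)
  qed
qed

lemma group_Aut_map: "group (Aut_map M)"
  unfolding Aut_map_def using subgroup_map_auts group_BijGroup by (rule subgroup.subgroup_is_group)

lemma mult_apply:
  assumes "\<phi> \<in> map_auts M" "\<psi> \<in> map_auts M" "x \<in> flags M"
  shows "(\<phi> \<otimes>\<^bsub>Aut_map M\<^esub> \<psi>) x = \<phi> (\<psi> x)"
  using assms by (simp add: Aut_map_def BijGroup_def map_auts_def compose_def)

lemma one_apply: "x \<in> flags M \<Longrightarrow> \<one>\<^bsub>Aut_map M\<^esub> x = x"
  by (simp add: Aut_map_def BijGroup_def)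

lemma
  assumes "\<phi> \<in> map_auts M" "x \<in> flags M"
  shows inv_apply: "(inv\<^bsub>Aut_map M\<^esub> \<phi>) (\<phi> x) = x"
    and apply_inv: "\<phi> ((inv\<^bsub>Aut_map M\<^esub> \<phi>) x) = x"
proof -
  interpret A: group "Aut_map M" by (rule group_Aut_map)
  have "inv\<^bsub>Aut_map M\<^esub> \<phi> \<in> map_auts M" "\<phi> \<in> carrier (Aut_map M)"
    using assms A.inv_closed by (simp_all add: carrier_Aut_map)
  then show "(inv\<^bsub>Aut_map M\<^esub> \<phi>) (\<phi> x) = x" "\<phi> ((inv\<^bsub>Aut_map M\<^esub> \<phi>) x) = x"
    using assms by (simp_all add: one_apply flip: mult_apply)
qed

text \<open>Presents \<open>Aut_plus\<close> as a restriction of \<open>Aut_map\<close> rather than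
  of \<open>BijGroup\<close>, so that inverses in the two groups can be compared.\<close>

lemma Aut_plus_eq: "G = (Aut_map M)\<lparr>carrier := carrier G\<rparr>"
  by (simp add: Aut_plus_def Aut_map_def)

lemma subgroup_Aut_plus: "subgroup (carrier G) (Aut_map M)"
proof -
  interpret A: group "Aut_map M" by (rule group_Aut_map)
  obtain x where x: "x \<in> flags M" using surface by (auto simp: surface_map_def)
  show ?thesis
  proof
    show "carrier G \<subseteq> carrier (Aut_map M)"
      using Aut_plus_map_auts by (auto simp: carrier_Aut_map)
    show "\<phi> \<otimes>\<^bsub>Aut_map M\<^esub> \<psi> \<in> carrier G" if "\<phi> \<in> carrier G" "\<psi> \<in> carrier G" for \<phi> \<psi>
      using that x A.m_closed[of \<phi> \<psi>] aut_orientation[of \<phi> x "\<psi> x"]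
      by (auto simp: carrier_Aut_plus[OF x] carrier_Aut_map mult_apply aut_flags)
    show "\<one>\<^bsub>Aut_map M\<^esub> \<in> carrier G"
      using A.one_closed by (simp add: carrier_Aut_plus[OF x] one_apply x carrier_Aut_map)
    show "inv\<^bsub>Aut_map M\<^esub> \<phi> \<in> carrier G" if "\<phi> \<in> carrier G" for \<phi>
    proof -
      have \<phi>: "\<phi> \<in> map_auts M" using that Aut_plus_map_auts by blast
      then have i: "inv\<^bsub>Aut_map M\<^esub> \<phi> \<in> map_auts M" using A.inv_closed by (simp add: carrier_Aut_map)
      show ?thesis
        using that aut_orientation[OF i x aut_flags[OF \<phi> x]] i
        by (auto simp: carrier_Aut_plus[OF x] inv_apply x)
    qed
  qed
qed

sublocale group G
  using subgroup.subgroup_is_group[OF subgroup_Aut_plus group_Aut_map] Aut_plus_eq by simp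

lemma mult_Aut_plus: "\<phi> \<otimes>\<^bsub>Aut_map M\<^esub> \<psi> = \<phi> \<otimes>\<^bsub>G\<^esub> \<psi>"
  by (simp add: Aut_plus_def Aut_map_def)

lemma inv_Aut_plus: "\<phi> \<in> carrier G \<Longrightarrow> inv\<^bsub>G\<^esub> \<phi> = inv\<^bsub>Aut_map M\<^esub> \<phi>"
  using group.m_inv_consistent[OF group_Aut_map subgroup_Aut_plus] Aut_plus_eq by metis

lemma plus_flags: "\<lbrakk>\<phi> \<in> carrier G; x \<in> flags M\<rbrakk> \<Longrightarrow> \<phi> x \<in> flags M"
  by (simp add: Aut_plus_map_auts aut_flags)

lemma plus_mult: "\<lbrakk>\<phi> \<in> carrier G; \<psi> \<in> carrier G; x \<in> flags M\<rbrakk> \<Longrightarrow> (\<phi> \<otimes>\<^bsub>G\<^esub> \<psi>) x = \<phi> (\<psi> x)"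
  using mult_apply[of \<phi> \<psi> x] by (simp add: Aut_plus_map_auts mult_Aut_plus)

lemma plus_one: "x \<in> flags M \<Longrightarrow> \<one>\<^bsub>G\<^esub> x = x"
  by (simp add: Aut_plus_def BijGroup_def)

lemma plus_inv:
  assumes "\<phi> \<in> carrier G" "x \<in> flags M"
  shows "(inv\<^bsub>G\<^esub> \<phi>) (\<phi> x) = x" "\<phi> ((inv\<^bsub>G\<^esub> \<phi>) x) = x"
  using assms inv_apply apply_inv by (simp_all add: inv_Aut_plus Aut_plus_map_auts)

lemma plus_eqI: "\<lbrakk>\<phi> \<in> carrier G; \<psi> \<in> carrier G; x \<in> flags M; \<phi> x = \<psi> x\<rbrakk> \<Longrightarrow> \<phi> = \<psi>"
  using aut_eqI Aut_plus_map_auts by blast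

lemma plus_orient: "\<lbrakk>\<phi> \<in> carrier G; x \<in> flags M\<rbrakk> \<Longrightarrow> c (\<phi> x) = c x"
  using carrier_Aut_plus by blast

section \<open>Flag transitivity, rotations and reflections\<close>

lemma plus_transitive:
  assumes "x \<in> flags M" "y \<in> flags M" "c x = c y"
  shows "\<exists>g\<in>carrier G. g x = y"
proof -
  obtain g where g: "g \<in> carrier G" "g ` directed_edge M x = directed_edge M y"
    using regular assms unfolding orientably_regular_def by blast
  then have "g x = y \<or> g x = r2 y" by (auto simp: directed_edge_def)
  \<comment> \<open>The two flags of a directed edge have opposite orientation, which pins down the
    image of \<open>x\<close>.\<close>
  moreover have "g x \<noteq> r2 y" using plus_orient[OF g(1)] assms c2 by metis
  ultimately show ?thesis using g(1) by blast
qed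

text \<open>For \<open>r = r2\<close> the element \<open>g\<close> rotates one step around the
  vertex of \<open>x\<close>, for \<open>r = r0\<close> around its face. Since \<open>g\<close>
  commutes with \<open>r\<close> and \<open>r1\<close>,
  \<open>g^(i+1) x = g^i (r (r1 x)) = r (r1 (g^i x))\<close>.\<close>

lemma rotation_flags:
  assumes g: "g \<in> carrier G" and x: "x \<in> flags M" and r: "r \<in> {r0, r2}" and gx: "g x = r (r1 x)"
  shows "r x = (inv\<^bsub>G\<^esub> g) (r1 x)"
    and "(inv\<^bsub>G\<^esub> g) x = r1 (r x)"
    and "r ((g [^]\<^bsub>G\<^esub> (i::nat)) x) \<in> flags M"
    and "c (r ((g [^]\<^bsub>G\<^esub> i) x)) \<noteq> c x"
    and "r1 ((g [^]\<^bsub>G\<^esub> i) x) = r ((g [^]\<^bsub>G\<^esub> Suc i) x)"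
    and "r (r ((g [^]\<^bsub>G\<^esub> i) x)) = (g [^]\<^bsub>G\<^esub> i) x"
proof -
  have rf: "r z \<in> flags M" "r (r z) = z" "c (r z) \<longleftrightarrow> \<not> c z" if "z \<in> flags M" for z
    using r that r0 r2 c0 c2 by auto
  have comm: "h (r z) = r (h z)" "h (r1 z) = r1 (h z)" if "h \<in> carrier G" "z \<in> flags M" for h z
    using r that aut_r0 aut_r1 aut_r2 Aut_plus_map_auts by auto
  have "g (r x) = r1 x"
    using comm[OF g x] gx x r1 rf by simp
  then show "r x = (inv\<^bsub>G\<^esub> g) (r1 x)"
    using plus_inv(1)[OF g rf(1)[OF x]] by simp
  have "g (r1 (r x)) = x"
    using comm(2)[OF g rf(1)[OF x]] \<open>g (r x) = r1 x\<close> r1 x by simp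
  then show "(inv\<^bsub>G\<^esub> g) x = r1 (r x)"
    using plus_inv(1)[OF g, of "r1 (r x)"] rf(1)[OF x] r1 by simp
  let ?h = "g [^]\<^bsub>G\<^esub> i"
  have h: "?h \<in> carrier G" using g by simp
  then have hf: "?h x \<in> flags M" using x plus_flags by blast
  then show "r (?h x) \<in> flags M" "r (r (?h x)) = ?h x" by (simp_all add: rf)
  show "c (r (?h x)) \<noteq> c x" using hf rf plus_orient[OF h x] by simp
  have "(g [^]\<^bsub>G\<^esub> Suc i) x = ?h (r (r1 x))" using gx plus_mult[OF h g x] by simp
  also have "\<dots> = r (r1 (?h x))" using comm[OF h] x r1 by simp
  finally show "r1 (?h x) = r ((g [^]\<^bsub>G\<^esub> Suc i) x)" using hf r1 rf by simp
qed

text \<open>The order of \<open>g\<close> is exactly \<open>m\<close>, the valency or the number of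
  sides: powers of \<open>g\<close> carry \<open>x\<close> once through the pairs
  \<open>{y, r y}\<close> around its vertex or face.\<close>

lemma rotation_order:
  assumes g: "g \<in> carrier G" and x: "x \<in> flags M" and r: "r \<in> {r0, r2}" and gx: "g x = r (r1 x)"
    and m: "card ((\<lambda>y. {y, r y}) ` reach {r, r1} x) = m" "m > 0"
  shows "\<And>d. \<lbrakk>d > 0; g [^]\<^bsub>G\<^esub> d = \<one>\<^bsub>G\<^esub>\<rbrakk> \<Longrightarrow> m \<le> d" and "g [^]\<^bsub>G\<^esub> m = \<one>\<^bsub>G\<^esub>"
proof -
  note rot = rotation_flags[OF g x r gx]
  let ?u = "\<lambda>i::nat. (g [^]\<^bsub>G\<^esub> i) x"
  let ?s = "\<lambda>y. {y, r y}"
  have u: "g [^]\<^bsub>G\<^esub> i \<in> carrier G" "?u i \<in> flags M" for i :: nat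
    using g x plus_flags by simp_all
  have u0: "?u 0 = x" using x by (simp add: plus_one)
  have u_Suc: "r (r1 (?u i)) = ?u (Suc i)" for i
    using rot(5)[of i] rot(6)[of "Suc i"] by simp
  show le: "m \<le> d" if d: "d > 0" "g [^]\<^bsub>G\<^esub> d = \<one>\<^bsub>G\<^esub>" for d
  proof -
    have ud: "?u d = x" using d x by (simp add: plus_one)
    have "\<exists>i. y = ?u i \<or> y = r (?u i)" if "y \<in> reach {r, r1} x" for y
      using that
    proof (induction rule: reach_induct)
      case refl
      then show ?case using u0 by metis
    next
      case (step z s)
      \<comment> \<open>Stepping back from exponent 0 wraps round to \<open>d - 1\<close>.\<close>
      have "r1 (r (?u i)) = ?u (if i = 0 then d - 1 else i - 1)" for i
      proof -
        define j where "j = (if i = 0 then d - 1 else i - 1)"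
        have "Suc j = i \<or> Suc j = d \<and> i = 0" using d(1) by (auto simp: j_def)
        then have "?u (Suc j) = ?u i" using u0 ud by metis
        then have "r1 (r (?u i)) = r1 (r1 (?u j))" using rot(5)[of j] rot(6)[of "Suc j"] by simp
        then show ?thesis using u r1 by (simp add: j_def)
      qed
      then show ?case using step rot(5,6) by (metis empty_iff insert_iff)
    qed
    then have "?s ` reach {r, r1} x \<subseteq> ?s ` range ?u"
      using rot(6) by (force simp: insert_commute)
    also have "range ?u \<subseteq> ?u ` {..<d}"
    proof safe
      fix i
      have "g [^]\<^bsub>G\<^esub> (d * (i div d)) = \<one>\<^bsub>G\<^esub>"
        using nat_pow_pow[OF g, of d "i div d"] d(2) by simp
      moreover have "g [^]\<^bsub>G\<^esub> i = g [^]\<^bsub>G\<^esub> (d * (i div d)) \<otimes>\<^bsub>G\<^esub> g [^]\<^bsub>G\<^esub> (i mod d)"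
        using g by (simp add: nat_pow_mult)
      ultimately have "?u i = ?u (i mod d)" using g by simp
      then show "?u i \<in> ?u ` {..<d}" using d(1) by (metis imageI lessThan_iff mod_less_divisor)
    qed
    then have "?s ` range ?u \<subseteq> ?s ` ?u ` {..<d}" by blast
    finally have "card (?s ` reach {r, r1} x) \<le> card (?s ` ?u ` {..<d})"
      by (intro card_mono) auto
    also have "\<dots> \<le> d"
      by (metis card_image_le card_lessThan finite_imageI finite_lessThan le_trans)
    finally show ?thesis using m by simp
  qed
  have "?u i \<in> reach {r, r1} x" for i
  proof (induction i)
    case (Suc i)
    then show ?case using u_Suc[of i] reach_step by (metis insertI1 insertI2)
  qed (simp add: plus_one x reach_refl)
  then have sub: "(?s \<circ> ?u) ` {..m} \<subseteq> ?s ` reach {r, r1} x" by auto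
  have "finite (?s ` reach {r, r1} x)" using m by (intro card_ge_0_finite) simp
  then have "card ((?s \<circ> ?u) ` {..m}) \<le> m" using card_mono[OF _ sub] m(1) by simp
  \<comment> \<open>There are \<open>m + 1\<close> exponents up to \<open>m\<close>, but at most
    \<open>m\<close> pairs.\<close>
  then have "\<not> inj_on (?s \<circ> ?u) {..m}" by (metis card_image card_atMost Suc_n_not_le_n)
  then obtain i j where "i < j" "j \<in> {..m}" "(?s \<circ> ?u) i = (?s \<circ> ?u) j"
    using linorder_inj_onI'[of "{..m}" "?s \<circ> ?u"] by blast
  then have ij: "i < j" "j \<le> m" "?s (?u i) = ?s (?u j)" by simp_all
  \<comment> \<open>Orientation excludes that the pairs coincide crosswise, with
    \<open>?u i = r (?u j)\<close>.\<close>
  have "c (?u i) = c x" using plus_orient u x by blast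
  then have eq: "?u i = ?u j" using ij(3) rot(4)[of j] by (auto simp: doubleton_eq_iff)
  have "g [^]\<^bsub>G\<^esub> i \<otimes>\<^bsub>G\<^esub> g [^]\<^bsub>G\<^esub> (j - i) = g [^]\<^bsub>G\<^esub> j"
    using nat_pow_mult[OF g, of i "j - i"] ij(1) by simp
  also have "\<dots> = g [^]\<^bsub>G\<^esub> i" using plus_eqI[OF u(1) u(1) x eq] by simp
  finally have one: "g [^]\<^bsub>G\<^esub> (j - i) = \<one>\<^bsub>G\<^esub>" using l_cancel_one[OF u(1) u(1)] by blast
  \<comment> \<open>\<open>j - i\<close> is a positive exponent at most \<open>m\<close>, and
    \<open>le\<close> gives the other bound.\<close>
  then have "j - i = m" using le[of "j - i"] ij by force
  with one show "g [^]\<^bsub>G\<^esub> m = \<one>\<^bsub>G\<^esub>" by simp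
qed

text \<open>The flags form two copies of \<open>G\<close>, namely \<open>g x\<close> and
  \<open>g (r1 x)\<close>. Here \<open>r1\<close> swaps the copies, while \<open>r2\<close> and
  \<open>r0\<close> send \<open>g x\<close> to \<open>(g a^-1) (r1 x)\<close> and
  \<open>(g b^-1) (r1 x)\<close>. So an automorphism inverting \<open>a\<close> and \<open>b\<close>
  respects all three exchanges when combined with the swap.\<close>

lemma reflection_exists:
  assumes x: "x \<in> flags M" and \<theta>: "\<theta> \<in> iso G G"
    and a: "a \<in> carrier G" "a x = r2 (r1 x)" "\<theta> a = inv\<^bsub>G\<^esub> a"
    and b: "b \<in> carrier G" "b x = r0 (r1 x)" "\<theta> b = inv\<^bsub>G\<^esub> b"
  shows "\<exists>\<sigma>\<in>map_auts M. \<sigma> x = r1 x \<and> (\<forall>f\<in>carrier G. \<forall>y\<in>flags M. \<sigma> (f y) = \<theta> f (\<sigma> y))"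
proof -
  interpret \<theta>: group_hom G G \<theta>
    using \<theta> by (simp add: group_hom_def group_hom_axioms_def iso_def is_group)
  have bij: "bij_betw \<theta> (carrier G) (carrier G)" using \<theta> by (simp add: iso_def)
  have x1: "r1 x \<in> flags M" "c (r1 x) \<longleftrightarrow> \<not> c x" "r1 (r1 x) = x" using x r1 c1 by auto
  \<comment> \<open>every flag is \<open>g x\<close> or \<open>g (r1 x)\<close> for a unique \<open>g\<close>; exchange these while applying \<open>\<theta>\<close> to \<open>g\<close>\<close>
  define e where "e y = (THE g. g \<in> carrier G \<and> g x = y)" for y
  define \<sigma> where "\<sigma> = (\<lambda>y\<in>flags M. if c y = c x then \<theta> (e y) (r1 x) else \<theta> (e (r1 y)) x)"
  have e: "e (g x) = g" if "g \<in> carrier G" for g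
    unfolding e_def using that plus_eqI x by blast
  have \<sigma>: "\<sigma> (g x) = \<theta> g (r1 x)" "\<sigma> (g (r1 x)) = \<theta> g x" if "g \<in> carrier G" for g
    using that x x1 plus_orient plus_flags e
    by (auto simp: \<sigma>_def simp flip: aut_r1[OF Aut_plus_map_auts])
  have cases: "\<exists>g\<in>carrier G. y = g x \<or> y = g (r1 x)" if "y \<in> flags M" for y
    using plus_transitive[OF x that] plus_transitive[OF x1(1) that] x1(2) by metis
  have \<sigma>_flags: "\<sigma> y \<in> flags M" if "y \<in> flags M" for y
    using cases[OF that] \<sigma> x x1 plus_flags by fastforce
  have \<sigma>_r1: "\<sigma> (r1 y) = r1 (\<sigma> y)" if y: "y \<in> flags M" for y
    using cases[OF y] \<sigma> x x1 aut_r1[OF Aut_plus_map_auts] by fastforce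
  \<comment> \<open>\<open>d\<close> stands for \<open>a\<close> when \<open>r = r2\<close> and for
    \<open>b\<close> when \<open>r = r0\<close>.\<close>
  have \<sigma>_r: "\<sigma> (r y) = r (\<sigma> y)" if y: "y \<in> flags M" and r: "r \<in> {r0, r2}"
    and d: "d \<in> carrier G" "d x = r (r1 x)" "\<theta> d = inv\<^bsub>G\<^esub> d" for y r d
  proof -
    have rf: "r z \<in> flags M" "r (r z) = z" "c (r z) \<longleftrightarrow> \<not> c z" if "z \<in> flags M" for z
      using r that r0 r2 c0 c2 by auto
    have comm: "h (r z) = r (h z)" if "h \<in> carrier G" "z \<in> flags M" for h z
      using r that aut_r0 aut_r2 Aut_plus_map_auts by auto
    have pos: "\<sigma> (r (g x)) = r (\<sigma> (g x))" if g: "g \<in> carrier G" for g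
    proof -
      have "r (g x) = (g \<otimes>\<^bsub>G\<^esub> inv\<^bsub>G\<^esub> d) (r1 x)"
        using comm[OF g x] rotation_flags(1)[OF d(1) x r d(2)] g d(1) plus_mult x1 by simp
      then have "\<sigma> (r (g x)) = \<theta> (g \<otimes>\<^bsub>G\<^esub> inv\<^bsub>G\<^esub> d) x" using \<sigma>(2) g d(1) by simp
      also have "\<dots> = \<theta> g (d x)" using g d x plus_mult by simp
      also have "\<dots> = r (\<theta> g (r1 x))" using comm d(2) x1 g by simp
      finally show ?thesis using \<sigma>(1)[OF g] by simp
    qed
    \<comment> \<open>If \<open>y\<close> lies in the other class, then \<open>r y\<close> lies in
      that of \<open>x\<close>, and \<open>pos\<close> applies to it.\<close>
    consider g where "g \<in> carrier G" "y = g x" | g where "g \<in> carrier G" "r y = g x"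
      using plus_transitive[OF x y] plus_transitive[OF x rf(1)[OF y]] rf(3)[OF y] by metis
    then show ?thesis
    proof cases
      case 1
      then show ?thesis using pos by simp
    next
      case 2
      then have "\<sigma> y = r (\<sigma> (r y))" using pos[of g] rf(2)[OF y] by metis
      then show ?thesis using rf \<sigma>_flags y by simp
    qed
  qed
  \<comment> \<open>On the finite flag set surjectivity suffices for bijectivity.\<close>
  have "flags M \<subseteq> \<sigma> ` flags M"
  proof
    fix y assume "y \<in> flags M"
    then obtain g where g: "g \<in> carrier G" "y = g x \<or> y = g (r1 x)" using cases by blast
    then obtain k where k: "k \<in> carrier G" "g = \<theta> k" using bij by (auto simp: bij_betw_def)
    then show "y \<in> \<sigma> ` flags M"
      using g(2) \<sigma>[OF k(1)] plus_flags[OF k(1)] x x1(1) by (metis imageI)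
  qed
  moreover have "finite (flags M)" using surface by (simp add: surface_map_def)
  ultimately have "bij_betw \<sigma> (flags M) (flags M)"
    using finite_surj_inj \<sigma>_flags unfolding bij_betw_def by (metis image_subsetI subset_antisym)
  moreover have "\<sigma> (r0 y) = r0 (\<sigma> y)" "\<sigma> (r2 y) = r2 (\<sigma> y)" if "y \<in> flags M" for y
    using \<sigma>_r[OF that] a b by blast+
  ultimately have "\<sigma> \<in> map_auts M"
    using \<sigma>_r1 by (auto simp: map_auts_def Bij_def \<sigma>_def)
  moreover have "\<sigma> x = r1 x" using \<sigma>(1)[OF one_closed] x x1(1) by (simp add: plus_one)
  moreover have "\<sigma> (f y) = \<theta> f (\<sigma> y)" if f: "f \<in> carrier G" and y: "y \<in> flags M" for f y
  proof -
    obtain g where g: "g \<in> carrier G" "y = g x \<or> y = g (r1 x)" using cases[OF y] by blast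
    then show ?thesis
      using \<sigma>[OF g(1)] \<sigma>[OF m_closed[OF f g(1)]] f x x1(1) by (auto simp: plus_mult)
  qed
  ultimately show ?thesis by blast
qed

section \<open>Full and inner regularity in terms of reflections\<close>

lemma fully_regular_if_reflection:
  assumes "x \<in> flags M" "\<sigma> \<in> map_auts M" "\<sigma> x = r1 x"
  shows "fully_regular M"
  unfolding fully_regular_def carrier_Aut_map
proof (intro conjI ballI surface)
  fix y z assume y: "y \<in> flags M" and z: "z \<in> flags M"
  \<comment> \<open>\<open>G\<close> is transitive on each class of flags, and
    \<open>\<sigma>\<close> swaps the two classes.\<close>
  have "c (\<sigma> y) \<noteq> c y" using aut_orientation[OF assms(2,1) y] assms c1 by simp
  then consider "c y = c z" | "c (\<sigma> y) = c z" by blast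
  then show "\<exists>\<phi>\<in>map_auts M. \<phi> y = z"
  proof cases
    case 1
    then show ?thesis using plus_transitive[OF y z] Aut_plus_map_auts by blast
  next
    case 2
    then obtain g where g: "g \<in> carrier G" "g (\<sigma> y) = z"
      using plus_transitive[OF aut_flags[OF assms(2) y] z] by blast
    then have "(g \<otimes>\<^bsub>Aut_map M\<^esub> \<sigma>) y = z"
      using mult_apply Aut_plus_map_auts assms(2) y by simp
    moreover have "g \<otimes>\<^bsub>Aut_map M\<^esub> \<sigma> \<in> map_auts M"
      using monoid.m_closed[OF group.is_monoid[OF group_Aut_map]] g(1) Aut_plus_map_auts assms(2)
      by (simp add: carrier_Aut_map)
    ultimately show ?thesis by blast
  qed
qed

text \<open>Conjugation by \<open>g\<close> inverts both rotations, so it extends to a reflection,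
  whose action on \<open>G\<close> is then that of \<open>g\<close>.\<close>

lemma inner_regularI:
  assumes x: "x \<in> flags M" and g: "g \<in> carrier G"
    and a: "a \<in> carrier G" "a x = r2 (r1 x)" "g \<otimes>\<^bsub>G\<^esub> a = inv\<^bsub>G\<^esub> a \<otimes>\<^bsub>G\<^esub> g"
    and b: "b \<in> carrier G" "b x = r0 (r1 x)" "g \<otimes>\<^bsub>G\<^esub> b = inv\<^bsub>G\<^esub> b \<otimes>\<^bsub>G\<^esub> g"
  shows "inner_regular M"
proof -
  interpret A: group "Aut_map M" by (rule group_Aut_map)
  obtain \<sigma> where \<sigma>: "\<sigma> \<in> map_auts M" "\<sigma> x = r1 x"
    and conj: "\<And>f y. \<lbrakk>f \<in> carrier G; y \<in> flags M\<rbrakk> \<Longrightarrow> \<sigma> (f y) = (g \<otimes>\<^bsub>G\<^esub> f \<otimes>\<^bsub>G\<^esub> inv\<^bsub>G\<^esub> g) (\<sigma> y)"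
    using reflection_exists[OF x conjugation_iso[OF g] a(1,2) _ b(1,2)] a b g
    by (auto simp: m_assoc)
  have "\<sigma> \<otimes>\<^bsub>Aut_map M\<^esub> f \<otimes>\<^bsub>Aut_map M\<^esub> inv\<^bsub>Aut_map M\<^esub> \<sigma> = g \<otimes>\<^bsub>G\<^esub> f \<otimes>\<^bsub>G\<^esub> inv\<^bsub>G\<^esub> g"
    if f: "f \<in> carrier G" for f
  proof -
    have k: "g \<otimes>\<^bsub>G\<^esub> f \<otimes>\<^bsub>G\<^esub> inv\<^bsub>G\<^esub> g \<in> map_auts M" using f g Aut_plus_map_auts by simp
    have f': "f \<in> map_auts M" using f Aut_plus_map_auts by simp
    \<comment> \<open>By rigidity it is enough to compare both sides at \<open>x\<close>.\<close>
    have "\<sigma> \<otimes>\<^bsub>Aut_map M\<^esub> f = (g \<otimes>\<^bsub>G\<^esub> f \<otimes>\<^bsub>G\<^esub> inv\<^bsub>G\<^esub> g) \<otimes>\<^bsub>Aut_map M\<^esub> \<sigma>"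
      by (rule aut_eqI[OF _ _ x])
        (use A.m_closed \<sigma> f f' k x conj in \<open>simp_all add: carrier_Aut_map mult_apply\<close>)
    then show ?thesis
      using A.inv_solve_right' \<sigma>(1) f' k A.m_closed by (metis carrier_Aut_map)
  qed
  moreover have "orientation_reversing M \<sigma>"
    using orientation_reversing_iff[OF \<sigma>(1) x] \<sigma>(2) c1 x by simp
  ultimately show ?thesis
    unfolding inner_regular_def carrier_Aut_map
    using fully_regular_if_reflection[OF x \<sigma>] \<sigma>(1) g by blast
qed

text \<open>The given \<open>\<sigma>\<close> need not take \<open>x\<close> to \<open>r1 x\<close>.
  Correcting it by some \<open>k\<close> in \<open>G\<close> achieves this and keeps the induced
  automorphism inner, now given by \<open>m = k^-1 g\<close>.\<close>

lemma inner_regularD: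
  assumes "inner_regular M" and x: "x \<in> flags M"
  shows "\<exists>m\<in>carrier G. \<forall>r\<in>{r0, r2}. \<forall>d\<in>carrier G. d x = r (r1 x) \<longrightarrow>
    m \<otimes>\<^bsub>G\<^esub> d = inv\<^bsub>G\<^esub> d \<otimes>\<^bsub>G\<^esub> m"
proof -
  interpret A: group "Aut_map M" by (rule group_Aut_map)
  obtain \<sigma> g where \<sigma>: "\<sigma> \<in> map_auts M" "orientation_reversing M \<sigma>" and g: "g \<in> carrier G"
    and eq: "\<And>f. f \<in> carrier G \<Longrightarrow>
      \<sigma> \<otimes>\<^bsub>Aut_map M\<^esub> f \<otimes>\<^bsub>Aut_map M\<^esub> inv\<^bsub>Aut_map M\<^esub> \<sigma> = g \<otimes>\<^bsub>G\<^esub> f \<otimes>\<^bsub>G\<^esub> inv\<^bsub>G\<^esub> g"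
    using assms(1) unfolding inner_regular_def carrier_Aut_map by blast
  have x1: "r1 x \<in> flags M" "r1 (r1 x) = x" using x r1 by auto
  have \<sigma>x: "\<sigma> x \<in> flags M" using aut_flags \<sigma>(1) x by blast
  have "c (r1 x) = c (\<sigma> x)" using orientation_reversing_iff[OF \<sigma>(1) x] \<sigma>(2) c1 x by simp
  then obtain k where k: "k \<in> carrier G" "k (r1 x) = \<sigma> x"
    using plus_transitive[OF x1(1) \<sigma>x] by blast
  have \<sigma>_conj: "\<sigma> (f x) = (g \<otimes>\<^bsub>G\<^esub> f \<otimes>\<^bsub>G\<^esub> inv\<^bsub>G\<^esub> g) (\<sigma> x)" if f: "f \<in> carrier G" for f
  proof -
    have "(inv\<^bsub>Aut_map M\<^esub> \<sigma>) (\<sigma> x) = x" "inv\<^bsub>Aut_map M\<^esub> \<sigma> \<in> map_auts M"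
        "\<sigma> \<otimes>\<^bsub>Aut_map M\<^esub> f \<in> map_auts M" "f \<in> map_auts M"
      using inv_apply[OF \<sigma>(1) x] A.inv_closed A.m_closed \<sigma>(1) f Aut_plus_map_auts
      by (simp_all add: carrier_Aut_map)
    then show ?thesis
      using \<sigma>x \<sigma>(1) x by (simp add: mult_apply flip: eq[OF f])
  qed
  define m where "m = inv\<^bsub>G\<^esub> k \<otimes>\<^bsub>G\<^esub> g"
  have m: "m \<in> carrier G" using g k by (simp add: m_def)
  have "m \<otimes>\<^bsub>G\<^esub> d = inv\<^bsub>G\<^esub> d \<otimes>\<^bsub>G\<^esub> m" if r: "r \<in> {r0, r2}" and d: "d \<in> carrier G" "d x = r (r1 x)" for r d
  proof -
    have "m \<otimes>\<^bsub>G\<^esub> d \<otimes>\<^bsub>G\<^esub> inv\<^bsub>G\<^esub> m = inv\<^bsub>G\<^esub> k \<otimes>\<^bsub>G\<^esub> (g \<otimes>\<^bsub>G\<^esub> d \<otimes>\<^bsub>G\<^esub> inv\<^bsub>G\<^esub> g \<otimes>\<^bsub>G\<^esub> k)"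
      using g k(1) d(1) by (simp add: m_def inv_mult_group m_assoc)
    then have "(m \<otimes>\<^bsub>G\<^esub> d \<otimes>\<^bsub>G\<^esub> inv\<^bsub>G\<^esub> m) (r1 x) = (inv\<^bsub>G\<^esub> k) ((g \<otimes>\<^bsub>G\<^esub> d \<otimes>\<^bsub>G\<^esub> inv\<^bsub>G\<^esub> g) (k (r1 x)))"
      using g k(1) d(1) x1(1) by (simp add: plus_mult)
    also have "\<dots> = (inv\<^bsub>G\<^esub> k) (\<sigma> (d x))" using \<sigma>_conj[OF d(1)] k(2) by simp
    also have "\<sigma> (d x) = r (r1 (k (r1 x)))"
      using d(2) k(2) r x x1 \<sigma>(1) aut_r0 aut_r1 aut_r2 by auto
    \<comment> \<open>\<open>k\<close> commutes with the exchanges, and the two copies of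
      \<open>r1\<close> cancel.\<close>
    also have "\<dots> = k (r x)"
      using k(1) r x x1 aut_r0 aut_r1 aut_r2 Aut_plus_map_auts by fastforce
    also have "(inv\<^bsub>G\<^esub> k) \<dots> = r x" using plus_inv(1) k(1) r x r0 r2 by auto
    also have "\<dots> = (inv\<^bsub>G\<^esub> d) (r1 x)" using rotation_flags(1)[OF d(1) x r d(2)] .
    finally have "m \<otimes>\<^bsub>G\<^esub> d \<otimes>\<^bsub>G\<^esub> inv\<^bsub>G\<^esub> m = inv\<^bsub>G\<^esub> d"
      using plus_eqI[OF _ _ x1(1)] m d(1) by simp
    then show ?thesis using inv_solve_right' m d(1) by (metis inv_closed m_closed)
  qed
  then show ?thesis using m by blast
qed

end

section \<open>The trace criterion for inner regularity\<close>

theorem theorem1p5: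
  fixes M :: "'f flag_system"
    and n :: nat
    and c :: "'f \<Rightarrow> bool"
    and v :: "'f set"
    and \<rho> :: "'f \<Rightarrow> 'f"
    and h :: "('f \<Rightarrow> 'f) \<Rightarrow> ('k::{field,finite}^2^2) set"
    and A :: "'k^2^2"
    and t :: 'k
  assumes "n \<ge> 7"
    and "Macbeath_map TYPE('k) n M"
    and "h \<in> iso (Aut_plus M) PSL2"
    and "orientation M c"
    and "v \<in> map_vertices M"
    and "vertex_rotation M c v \<rho>"
    and "A \<in> h \<rho>"
    and "t = trace A"
  shows "((\<exists>s. 3 - t\<^sup>2 = s\<^sup>2) \<longrightarrow> inner_regular M) \<and>
         (\<not> (\<exists>s. 3 - t\<^sup>2 = s\<^sup>2) \<longrightarrow> outer_regular M)"
proof -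
  have type: "has_type M 3 n" using assms(2) by (simp add: Macbeath_map_def)
  interpret oriented_regular_map M c
    using assms(2,4) by unfold_locales (simp_all add: Macbeath_map_def)
  have r: "r0 \<in> {r0, r2}" "r2 \<in> {r0, r2}" by simp_all
  obtain z where z: "z \<in> flags M" "v = reach {r1, r2} z"
    using assms(5) by (auto simp: map_vertices_def)
  \<comment> \<open>A positive flag at \<open>v\<close>, since \<open>vertex_rotation\<close>
    prescribes \<open>\<rho>\<close> on positive flags.\<close>
  define x where "x = (if c z then z else r1 z)"
  have x: "x \<in> flags M" "c x" using z r1 c1 by (auto simp: x_def)
  have v: "v = reach {r1, r2} x" using z r1 by (simp add: x_def reach_involution)
  have \<rho>: "\<rho> \<in> carrier G" "\<rho> x = r2 (r1 x)"
    using assms(6) x(2) reach_refl[of x] v by (auto simp: vertex_rotation_def)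
  have xr: "r1 x \<in> flags M" "r0 (r1 x) \<in> flags M" "c (r0 (r1 x))"
    using x r0 r1 c0 c1 by auto
  \<comment> \<open>\<open>b\<close> is the one-step rotation around the face of
    \<open>x\<close>.\<close>
  obtain b where b: "b \<in> carrier G" "b x = r0 (r1 x)"
    using plus_transitive[OF x(1) xr(2)] x(2) xr(3) by blast
  have "card (directed_edge M ` v) = n" "card (face_side M ` reach {r0, r1} x) = 3"
    using type assms(5) x(1) by (auto simp: has_type_def map_faces_def)
  then have cards: "card ((\<lambda>y. {y, r2 y}) ` reach {r2, r1} x) = n" "card ((\<lambda>y. {y, r0 y}) ` reach {r0, r1} x) = 3"
    unfolding v by (simp_all add: directed_edge_def[abs_def] face_side_def[abs_def] insert_commute)
  \<comment> \<open>Here \<open>n >= 7\<close> enters: it excludes the exceptional traces.\<close>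
  have "\<rho> [^]\<^bsub>G\<^esub> (6::nat) \<noteq> \<one>\<^bsub>G\<^esub>"
    using rotation_order(1)[OF \<rho>(1) x(1) r(2) \<rho>(2) cards(1), of 6] assms(1) by auto
  then have \<rho>6: "(\<rho> \<otimes>\<^bsub>G\<^esub> \<rho>) \<otimes>\<^bsub>G\<^esub> (\<rho> \<otimes>\<^bsub>G\<^esub> \<rho>) \<otimes>\<^bsub>G\<^esub> (\<rho> \<otimes>\<^bsub>G\<^esub> \<rho>) \<noteq> \<one>\<^bsub>G\<^esub>"
    using \<rho>(1) by (simp add: numeral_eq_Suc m_assoc)
  \<comment> \<open>The inverse is taken so that \<open>?y\<close> times \<open>\<rho>\<close> is
    the half-turn about the edge of \<open>x\<close>, sending \<open>x\<close> to
    \<open>r2 (r0 x)\<close>.\<close>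
  let ?y = "inv\<^bsub>G\<^esub> b"
  have y: "?y \<in> carrier G" using b by simp
  have "b [^]\<^bsub>G\<^esub> (1::nat) \<noteq> \<one>\<^bsub>G\<^esub>" "b [^]\<^bsub>G\<^esub> (3::nat) = \<one>\<^bsub>G\<^esub>"
    using rotation_order[OF b(1) x(1) r(1) b(2) cards(2)] by force+
  then have "b \<noteq> \<one>\<^bsub>G\<^esub>" "inv\<^bsub>G\<^esub> (b \<otimes>\<^bsub>G\<^esub> b \<otimes>\<^bsub>G\<^esub> b) = \<one>\<^bsub>G\<^esub>"
    using b(1) by (simp_all add: numeral_eq_Suc)
  then have y3: "?y \<otimes>\<^bsub>G\<^esub> ?y \<otimes>\<^bsub>G\<^esub> ?y = \<one>\<^bsub>G\<^esub>" "?y \<noteq> \<one>\<^bsub>G\<^esub>"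
    using b(1) by (simp_all add: inv_mult_group m_assoc inv_eq_1_iff)
  let ?w = "?y \<otimes>\<^bsub>G\<^esub> \<rho>"
  have w: "?w \<in> carrier G" using y \<rho> by simp
  have "?y x = r1 (r0 x)" using rotation_flags(2)[OF b(1) x(1) r(1) b(2)] by simp
  then have "?w x = r2 (r1 (r1 (r0 x)))"
    using plus_mult[OF y \<rho>(1) x(1)] \<rho>(2) aut_r1[OF Aut_plus_map_auts[OF y]]
      aut_r2[OF Aut_plus_map_auts[OF y]] x(1) r1 by simp
  then have wx: "?w x = r2 (r0 x)" using r0 r1 x(1) by simp
  have "(?w \<otimes>\<^bsub>G\<^esub> ?w) x = r2 (r0 (?w x))"
    using plus_mult[OF w w x(1)] wx aut_r0[OF Aut_plus_map_auts[OF w]]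
      aut_r2[OF Aut_plus_map_auts[OF w]] x(1) r0 by simp
  also have "\<dots> = x" using x(1) wx r0 r2 r02 by simp
  finally have w2: "?w \<otimes>\<^bsub>G\<^esub> ?w = \<one>\<^bsub>G\<^esub>"
    using plus_eqI[OF _ one_closed x(1)] w plus_one x(1) by simp
  \<comment> \<open>The half-turn is nontrivial because there are no semi-edges.\<close>
  have w1: "?w \<noteq> \<one>\<^bsub>G\<^esub>" using wx plus_one x(1) r02 by metis
  note alg = inverting_in_group_iso_PSL2[OF is_group assms(3) \<rho>(1) y assms(7) \<rho>6 y3 w2 w1]
  obtain \<theta> where \<theta>: "\<theta> \<in> iso G G" "\<theta> \<rho> = inv\<^bsub>G\<^esub> \<rho>" "\<theta> ?y = inv\<^bsub>G\<^esub> ?y"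
    using alg(1) by blast
  interpret \<theta>: group_hom G G \<theta>
    using \<theta> by (simp add: group_hom_def group_hom_axioms_def iso_def is_group)
  have "\<theta> b = ?y" using \<theta>.hom_inv[OF y] \<theta>(3) b(1) by simp
  \<comment> \<open>A reflection exists whether or not \<open>3 - t^2\<close> is a square, so
    failure of inner regularity means outer regularity.\<close>
  then have full: "fully_regular M"
    using reflection_exists[OF x(1) \<theta>(1) \<rho> \<theta>(2) b] fully_regular_if_reflection[OF x(1)] by blast
  have b_iff: "g \<otimes>\<^bsub>G\<^esub> b = inv\<^bsub>G\<^esub> b \<otimes>\<^bsub>G\<^esub> g \<longleftrightarrow> g \<otimes>\<^bsub>G\<^esub> ?y = inv\<^bsub>G\<^esub> ?y \<otimes>\<^bsub>G\<^esub> g"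
    if "g \<in> carrier G" for g
    using that b(1) by (metis inv_closed inv_inv inv_solve_left inv_solve_right m_closed m_assoc)
  have "(\<exists>s. 3 - t\<^sup>2 = s\<^sup>2) \<longleftrightarrow> inner_regular M"
  proof
    assume "\<exists>s. 3 - t\<^sup>2 = s\<^sup>2"
    then obtain g where "g \<in> carrier G" "g \<otimes>\<^bsub>G\<^esub> \<rho> = inv\<^bsub>G\<^esub> \<rho> \<otimes>\<^bsub>G\<^esub> g" "g \<otimes>\<^bsub>G\<^esub> b = inv\<^bsub>G\<^esub> b \<otimes>\<^bsub>G\<^esub> g"
      using alg(2) b_iff assms(8) by blast
    then show "inner_regular M" using inner_regularI[OF x(1)] \<rho> b by blast
  next
    assume "inner_regular M"
    then obtain g where "g \<in> carrier G" "g \<otimes>\<^bsub>G\<^esub> \<rho> = inv\<^bsub>G\<^esub> \<rho> \<otimes>\<^bsub>G\<^esub> g" "g \<otimes>\<^bsub>G\<^esub> b = inv\<^bsub>G\<^esub> b \<otimes>\<^bsub>G\<^esub> g"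
      using inner_regularD[OF _ x(1)] \<rho> b by blast
    then show "\<exists>s. 3 - t\<^sup>2 = s\<^sup>2" using alg(2) b_iff assms(8) by blast
  qed
  then show ?thesis using full by (simp add: outer_regular_def)
qed

end
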